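(* Let $E,F\subseteq\mathbb R^2$ be finite sets with $|E|=|F|=n$ ($n$ large), and suppose that every line through the origin contains at most $n^{2/3}$ points of $E$. Then there is a subset $E'\subseteq E$ with $|E'|\ge \frac12 n$ such that for every $x\in E'$, \[|\Pi_x(F)|=|\{x\cdot q: q\in F\}|\gtrsim n^{2/3}.\] Moreover, if $E=F$, the same conclusion holds without the hypothesis on the number of points of $E$ on lines through the origin.
   Context: $x\cdot q$ is the standard dot product on $\mathbb R^2$, and $\Pi_x(F)=\{x\cdot q:q\in F\}$ is the pinned dot product set. The notation $X\gtrsim Y$ means $X\ge cY$ for an absolute constant $c>0$. *)

theory Defs
  imports "HOL-Analysis.Analysis"
begin

definition line_through_origin :: "(real^2) set \<Rightarrow> bool" where
  "line_through_origin L \<longleftrightarrow> subspace L \<and> dim L = 1"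

definition pinned_dot_product_set :: "real^2 \<Rightarrow> (real^2) set \<Rightarrow> real set" where
  "pinned_dot_product_set x F = {x \<bullet> q | q. q \<in> F}"

end

theory Submission
  imports Defs
begin

text \<open>If \<open>x\<close> has few dot products with \<open>F\<close>, then \<open>F\<close> is covered by few lines orthogonal to \<open>x\<close>. Many
  such \<open>x\<close>, at most \<open>n powr (2/3)\<close> of them on each line through the origin, give about
  \<open>n powr (1/3)\<close> directions, in each of which \<open>F\<close> is covered by few lines. This contradicts the Szemeredi-Trotter bound, which is
  obtained here as in Szekely's argument: joining consecutive points on the lines gives a graph
  drawn with straight edges; a crossing-free such graph has linearly many edges, random sampling of
  vertices turns this into a lower bound for the number of crossings, and two lines cross at most
  once.\<close>

section \<open>Crossings of straight edges\<close>

text \<open>An edge is an ordered pair with its left endpoint first. The graphs below have no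
  vertical edges, so the quotient is a true slope for them.\<close>

definition slope :: "(real^2) \<times> (real^2) \<Rightarrow> real" where
  "slope e = (snd e $ 2 - fst e $ 2) / (snd e $ 1 - fst e $ 1)"

text \<open>The affine function of the whole supporting line, so it may also be evaluated beyond the
  ends of the edge.\<close>

definition height :: "(real^2) \<times> (real^2) \<Rightarrow> real \<Rightarrow> real" where
  "height e x = fst e $ 2 + slope e * (x - fst e $ 1)"

text \<open>The strict inequalities exclude meetings at an endpoint of either edge, and the
  condition on slopes excludes overlaps of collinear edges. Vertices may therefore lie on edges of a
  crossing-free graph.\<close>

definition crossing :: "(real^2) \<times> (real^2) \<Rightarrow> (real^2) \<times> (real^2) \<Rightarrow> bool" where
  "crossing e f \<longleftrightarrow> slope e \<noteq> slope f \<and>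
     (\<exists>x. fst e $ 1 < x \<and> x < snd e $ 1 \<and> fst f $ 1 < x \<and> x < snd f $ 1 \<and> height e x = height f x)"

lemma height_shift: "height e x = height e y + slope e * (x - y)"
  by (simp add: height_def algebra_simps)

lemma height_fst [simp]: "height e (fst e $ 1) = fst e $ 2"
  by (simp add: height_def)

lemma height_snd [simp]: "fst e $ 1 < snd e $ 1 \<Longrightarrow> height e (snd e $ 1) = snd e $ 2"
  by (simp add: height_def slope_def)

lemma point_eqI: "u $ 1 = v $ 1 \<Longrightarrow> u $ 2 = v $ 2 \<Longrightarrow> u = (v :: real^2)"
  by (simp add: vec_eq_iff forall_2)

text \<open>The difference of the two heights is affine and changes sign from \<open>a\<close> to
  \<open>b\<close>, so it is not constant and vanishes strictly in between, where both edges are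
  present.\<close>

lemma crossingI:
  assumes "height f a < height e a" "height e b < height f b" "a < b"
    and "fst e $ 1 \<le> a" "fst f $ 1 \<le> a" "b \<le> snd e $ 1" "b \<le> snd f $ 1"
  shows "crossing e f"
proof -
  define d where "d = height e a - height f a"
  define p where "p = slope f - slope e"
  have diff: "height e x - height f x = d - p * (x - a)" for x
    using height_shift[of e x a] height_shift[of f x a] by (simp add: d_def p_def algebra_simps)
  have d: "d > 0" using assms(1) by (simp add: d_def)
  have b: "d < p * (b - a)" using diff[of b] assms(2) by simp
  then have "0 < p * (b - a)" using d by linarith
  then have p: "p > 0" using assms(3) by (simp add: zero_less_mult_iff)
  define x where "x = a + d / p"
  have "a < x" using d p by (simp add: x_def)
  moreover have "x < b" using b p by (simp add: x_def field_simps)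
  moreover have "height e x = height f x" using diff[of x] p by (simp add: x_def)
  ultimately show ?thesis
    unfolding crossing_def using p assms(4-) by (intro conjI exI[of _ x]) (auto simp: p_def order_le_less_trans order_less_le_trans)
qed

lemma height_less_left:
  assumes "slope f < slope e" "height e b = height f b" "x < b"
  shows "height e x < height f x"
proof -
  have "(slope e - slope f) * (x - b) < 0"
    using assms by (simp add: mult_pos_neg)
  then show ?thesis
    using height_shift[of e x b] height_shift[of f x b] assms(2) by (simp add: algebra_simps)
qed

lemma height_less_right:
  assumes "slope e < slope f" "height e a = height f a" "a < x"
  shows "height e x < height f x"
proof -
  have "(slope f - slope e) * (x - a) > 0"
    using assms by simp
  then show ?thesis
    using height_shift[of e x a] height_shift[of f x a] assms(2) by (simp add: algebra_simps)
qed

section \<open>Plane graphs with straight edges\<close>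

text \<open>Collinear edges may overlap, but not when they leave the same left endpoint: by
  \<open>edge_eqI\<close> the edges leaving a vertex to the right are strictly ordered by
  slope.\<close>

locale noncrossing_graph =
  fixes S :: "(real^2) set" and Ed :: "((real^2) \<times> (real^2)) set"
  assumes finite_S: "finite S"
    and edges_sub: "Ed \<subseteq> S \<times> S"
    and edge_less: "e \<in> Ed \<Longrightarrow> fst e $ 1 < snd e $ 1"
    and edge_eqI: "e \<in> Ed \<Longrightarrow> f \<in> Ed \<Longrightarrow> fst e = fst f \<Longrightarrow> slope e = slope f \<Longrightarrow> e = f"
    and noncrossing: "e \<in> Ed \<Longrightarrow> f \<in> Ed \<Longrightarrow> \<not> crossing e f"
begin

section \<open>The wedge between consecutive edges and its first vertex\<close>

definition wedge :: "(real^2) \<times> (real^2) \<Rightarrow> (real^2) \<times> (real^2) \<Rightarrow> (real^2) set" where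
  "wedge e f = {z \<in> S. fst e $ 1 < z $ 1 \<and> height e (z $ 1) \<le> z $ 2 \<and> z $ 2 \<le> height f (z $ 1)}"

definition next_edge where
  "next_edge e f \<longleftrightarrow> f \<in> Ed \<and> fst f = fst e \<and> slope e < slope f \<and>
     (\<forall>g\<in>Ed. fst g = fst e \<longrightarrow> slope e < slope g \<longrightarrow> slope f \<le> slope g)"

text \<open>A relation, not a function: several vertices of the wedge may share the least first
  coordinate, and any of them will do.\<close>

definition first_vertex where
  "first_vertex e w \<longleftrightarrow> (\<exists>f. next_edge e f \<and> w \<in> wedge e f \<and> (\<forall>z\<in>wedge e f. w $ 1 \<le> z $ 1))"

lemma edge_vertices: "e \<in> Ed \<Longrightarrow> fst e \<in> S" "e \<in> Ed \<Longrightarrow> snd e \<in> S"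
  using edges_sub by (metis mem_Times_iff subsetD)+

lemma finite_Ed: "finite Ed"
  using finite_S edges_sub by (meson finite_SigmaI finite_subset)

lemma first_vertex_exists:
  assumes "e \<in> Ed" "g \<in> Ed" "fst g = fst e" "slope e < slope g"
  shows "\<exists>w. first_vertex e w"
proof -
  define G where "G = {g \<in> Ed. fst g = fst e \<and> slope e < slope g}"
  have "g \<in> G" using assms by (simp add: G_def)
  moreover have "finite G" using finite_Ed by (simp add: G_def)
  ultimately have G: "finite G" "G \<noteq> {}" by blast+
  define f where "f = arg_min_on slope G"
  have "f \<in> G" "\<And>h. h \<in> G \<Longrightarrow> slope f \<le> slope h"
    using arg_min_if_finite[OF G, of slope] by (force simp: f_def)+
  then have f: "next_edge e f" by (auto simp: next_edge_def G_def)
  \<comment> \<open>Wedges contain their boundary lines, so the right endpoint of \<open>e\<close>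
    witnesses that this one is nonempty.\<close>
  have "snd e \<in> wedge e f"
    using assms edge_vertices[of e] edge_less[of e] f height_less_right[of e f "fst e $ 1" "snd e $ 1"]
      height_fst[of f]
    by (auto simp: wedge_def next_edge_def)
  then have W: "wedge e f \<noteq> {}" "finite (wedge e f)"
    using finite_S by (auto simp: wedge_def)
  define w where "w = arg_min_on (\<lambda>z. z $ 1) (wedge e f)"
  have "w \<in> wedge e f" "\<And>z. z \<in> wedge e f \<Longrightarrow> w $ 1 \<le> z $ 1"
    using arg_min_if_finite[OF W(2,1), of "\<lambda>z. z $ 1"] by (force simp: w_def)+
  then show ?thesis using f unfolding first_vertex_def by blast
qed

text \<open>Both right endpoints lie in the wedge, so \<open>w\<close> is to the right of neither.
  Up to \<open>w\<close> the two sides of the wedge are thus actual edges, which is what makes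
  \<open>crossingI\<close> applicable to them.\<close>

lemma first_vertexE:
  assumes "first_vertex e w" "e \<in> Ed"
  obtains f where "f \<in> Ed" "fst f = fst e" "slope e < slope f"
    "\<And>g. g \<in> Ed \<Longrightarrow> fst g = fst e \<Longrightarrow> slope e < slope g \<Longrightarrow> slope f \<le> slope g"
    "w \<in> S" "fst e $ 1 < w $ 1" "height e (w $ 1) \<le> w $ 2" "w $ 2 \<le> height f (w $ 1)"
    "w $ 1 \<le> snd e $ 1" "w $ 1 \<le> snd f $ 1"
    "\<And>z. z \<in> S \<Longrightarrow> fst e $ 1 < z $ 1 \<Longrightarrow> height e (z $ 1) \<le> z $ 2 \<Longrightarrow> z $ 2 \<le> height f (z $ 1) \<Longrightarrow> w $ 1 \<le> z $ 1"
proof -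
  obtain f where f: "next_edge e f" and w: "w \<in> wedge e f"
    and min: "\<And>z. z \<in> wedge e f \<Longrightarrow> w $ 1 \<le> z $ 1"
    using assms by (auto simp: first_vertex_def)
  have f': "f \<in> Ed" "fst f = fst e" "slope e < slope f" using f by (auto simp: next_edge_def)
  have lt: "height e x < height f x" if "fst e $ 1 < x" for x
    using height_less_right[of e f "fst e $ 1" x] f' height_fst[of f] that by simp
  have "snd e \<in> wedge e f" "snd f \<in> wedge e f"
    using assms(2) f' edge_vertices edge_less[of e] edge_less[of f] lt[of "snd e $ 1"] lt[of "snd f $ 1"]
    by (auto simp: wedge_def order_less_imp_le)
  then have "w $ 1 \<le> snd e $ 1" "w $ 1 \<le> snd f $ 1" using min by auto
  then show ?thesis using that[of f] f w min unfolding next_edge_def wedge_def by blast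
qed

text \<open>If \<open>e\<close> were steeper than \<open>e'\<close>, then \<open>e'\<close> would
  run above \<open>e\<close> to the left of \<open>w\<close>, yet not above the next edge
  \<open>f\<close>, which it cannot cross. It would have to start inside the wedge of
  \<open>e\<close>, before the first vertex.\<close>

lemma first_vertex_on_edge_slope:
  assumes "e \<in> Ed" "e' \<in> Ed" "first_vertex e w" "first_vertex e' w"
    and "height e (w $ 1) = w $ 2" "height e' (w $ 1) = w $ 2"
  shows "slope e \<le> slope e'"
proof (rule ccontr)
  assume "\<not> slope e \<le> slope e'"
  then have s: "slope e' < slope e" by simp
  obtain f where f: "f \<in> Ed" "fst f = fst e" "slope e < slope f"
    and w: "fst e $ 1 < w $ 1" "w $ 1 \<le> snd f $ 1"
    and min: "\<And>z. z \<in> S \<Longrightarrow> fst e $ 1 < z $ 1 \<Longrightarrow> height e (z $ 1) \<le> z $ 2 \<Longrightarrow> z $ 2 \<le> height f (z $ 1) \<Longrightarrow> w $ 1 \<le> z $ 1"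
    using first_vertexE[OF assms(3,1)] by metis
  have w': "fst e' $ 1 < w $ 1" "w $ 1 \<le> snd e' $ 1"
    using first_vertexE[OF assms(4,2)] by metis+
  \<comment> \<open>The abscissa from which both edges are present. If it belongs to
    \<open>e\<close>, then \<open>e\<close> and \<open>f\<close> meet there and leave no room for
    \<open>e'\<close>; otherwise the left endpoint of \<open>e'\<close> is a vertex in the
    wedge.\<close>
  define m where "m = max (fst e $ 1) (fst e' $ 1)"
  have m: "m < w $ 1" "fst e $ 1 \<le> m" "fst e' $ 1 \<le> m" using w w' by (auto simp: m_def)
  have fe: "height f (fst e $ 1) = fst e $ 2" using f(2) height_fst[of f] by simp
  have up: "height e' (w $ 1) < height f (w $ 1)"
    using height_less_right[of e f "fst e $ 1" "w $ 1"] f w fe assms(5,6) by simp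
  have le: "height e' m \<le> height f m"
    using crossingI[of f m e' "w $ 1"] noncrossing[OF assms(2) f(1)] up m w w' f(2) by force
  have lt: "height e m < height e' m"
    using height_less_left[of e' e "w $ 1" m] s m assms(5,6) by simp
  have "fst e $ 1 < fst e' $ 1"
  proof (rule ccontr)
    assume "\<not> fst e $ 1 < fst e' $ 1"
    then have "m = fst e $ 1" by (simp add: m_def)
    then show False using le lt fe by simp
  qed
  then have "m = fst e' $ 1" by (simp add: m_def)
  then have "w $ 1 \<le> fst e' $ 1"
    using min[of "fst e'"] le lt \<open>fst e $ 1 < fst e' $ 1\<close> edge_vertices(1)[OF assms(2)]
    by auto
  then show False using w' by simp
qed

text \<open>Both edges lie on one line through \<open>w\<close>; a left endpoint of
  \<open>e'\<close> further right would be an earlier vertex on the lower side of the wedge of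
  \<open>e\<close>.\<close>

lemma first_vertex_on_edge_left:
  assumes "e \<in> Ed" "e' \<in> Ed" "first_vertex e w" "first_vertex e' w" "slope e = slope e'"
    and "height e (w $ 1) = w $ 2" "height e' (w $ 1) = w $ 2"
  shows "fst e' $ 1 \<le> fst e $ 1"
proof (rule ccontr)
  assume *: "\<not> fst e' $ 1 \<le> fst e $ 1"
  obtain f where f: "f \<in> Ed" "fst f = fst e" "slope e < slope f"
    and min: "\<And>z. z \<in> S \<Longrightarrow> fst e $ 1 < z $ 1 \<Longrightarrow> height e (z $ 1) \<le> z $ 2 \<Longrightarrow> z $ 2 \<le> height f (z $ 1) \<Longrightarrow> w $ 1 \<le> z $ 1"
    using first_vertexE[OF assms(3,1)] by metis
  have w': "fst e' $ 1 < w $ 1"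
    using first_vertexE[OF assms(4,2)] by metis
  have "height e x = height e' x" for x
    using height_shift[of e x "w $ 1"] height_shift[of e' x "w $ 1"] assms by simp
  then have "height e (fst e' $ 1) = fst e' $ 2" by simp
  moreover have "height e (fst e' $ 1) < height f (fst e' $ 1)"
    using height_less_right[of e f "fst e $ 1" "fst e' $ 1"] f * height_fst[of f] by simp
  ultimately have "w $ 1 \<le> fst e' $ 1"
    using min[of "fst e'"] * edge_vertices(1)[OF assms(2)] by auto
  then show False using w' by simp
qed

lemma first_vertex_on_edge_inj:
  assumes "e \<in> Ed" "e' \<in> Ed" "first_vertex e w" "first_vertex e' w"
    and "height e (w $ 1) = w $ 2" "height e' (w $ 1) = w $ 2"
  shows "e = e'"
proof -
  have s: "slope e = slope e'"
    using first_vertex_on_edge_slope[of e e' w] first_vertex_on_edge_slope[of e' e w] assms by force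
  have 1: "fst e $ 1 = fst e' $ 1"
    using first_vertex_on_edge_left[of e e' w] first_vertex_on_edge_left[of e' e w] assms s by force
  have "fst e $ 2 = fst e' $ 2"
    using height_shift[of e "fst e $ 1" "w $ 1"] height_shift[of e' "fst e' $ 1" "w $ 1"]
      height_fst[of e] height_fst[of e'] assms(5,6) s 1
    by (metis)
  then show ?thesis using edge_eqI[OF assms(1,2) point_eqI] 1 s by blast
qed

text \<open>The later left endpoint, that of \<open>e'\<close>, is squeezed into the wedge of
  \<open>e\<close>: above \<open>f\<close> it would force \<open>e'\<close> to cross
  \<open>f\<close>, and below \<open>e\<close> it would force \<open>f'\<close> to cross
  \<open>e\<close>. Only the apex of that wedge is possible, as other vertices in it are not to the
  left of \<open>w\<close>.\<close>

lemma first_vertex_above_edge_left: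
  assumes "e \<in> Ed" "e' \<in> Ed" "first_vertex e w" "first_vertex e' w"
    and "height e (w $ 1) < w $ 2" "height e' (w $ 1) < w $ 2" "fst e $ 1 \<le> fst e' $ 1"
  shows "fst e = fst e'"
proof (rule ccontr)
  assume ne: "fst e \<noteq> fst e'"
  obtain f where f: "f \<in> Ed" "fst f = fst e" "slope e < slope f"
    and w: "fst e $ 1 < w $ 1" "w $ 2 \<le> height f (w $ 1)" "w $ 1 \<le> snd e $ 1" "w $ 1 \<le> snd f $ 1"
    and min: "\<And>z. z \<in> S \<Longrightarrow> fst e $ 1 < z $ 1 \<Longrightarrow> height e (z $ 1) \<le> z $ 2 \<Longrightarrow> z $ 2 \<le> height f (z $ 1) \<Longrightarrow> w $ 1 \<le> z $ 1"
    using first_vertexE[OF assms(3,1)] by metis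
  obtain f' where f': "f' \<in> Ed" "fst f' = fst e'" "slope e' < slope f'"
    and w': "fst e' $ 1 < w $ 1" "w $ 2 \<le> height f' (w $ 1)" "w $ 1 \<le> snd e' $ 1" "w $ 1 \<le> snd f' $ 1"
    using first_vertexE[OF assms(4,2)] by metis
  let ?x = "fst e' $ 1"
  have fe: "height f (fst e $ 1) = fst e $ 2" using f(2) height_fst[of f] by simp
  have fe': "height f' ?x = fst e' $ 2" using f'(2) height_fst[of f'] by simp
  have 1: "fst e' $ 2 \<le> height f ?x"
    using crossingI[of f ?x e' "w $ 1"] noncrossing[OF assms(2) f(1)] w w' assms f(2) by force
  have 2: "height e ?x \<le> fst e' $ 2"
    using crossingI[of f' ?x e "w $ 1"] noncrossing[OF assms(1) f'(1)] w w' assms f'(2) fe' by force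
  show False
  proof (cases "fst e $ 1 < ?x")
    case True
    then show False using 1 2 min[of "fst e'"] w' edge_vertices(1)[OF assms(2)]
      by auto
  next
    case False
    then have x: "fst e $ 1 = ?x" using assms by simp
    then have "fst e $ 2 = fst e' $ 2" using 1 2 fe height_fst[of e] by simp
    then show False using ne x point_eqI by blast
  qed
qed

lemma first_vertex_above_edge_inj:
  assumes "e \<in> Ed" "e' \<in> Ed" "first_vertex e w" "first_vertex e' w"
    and "height e (w $ 1) < w $ 2" "height e' (w $ 1) < w $ 2"
  shows "e = e'"
proof -
  have v: "fst e = fst e'"
    using first_vertex_above_edge_left[of e e' w] first_vertex_above_edge_left[of e' e w] assms
    by (metis linear)
  \<comment> \<open>A steeper \<open>b\<close> would be at least as steep as the edge following
    \<open>a\<close>, so \<open>w\<close>, lying in the wedge of \<open>a\<close>, could not be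
    above \<open>b\<close>.\<close>
  have *: "slope b \<le> slope a"
    if ab: "a \<in> Ed" "b \<in> Ed" "first_vertex a w" "height b (w $ 1) < w $ 2" "fst a = fst b" for a b
  proof (rule ccontr)
    assume "\<not> slope b \<le> slope a"
    obtain f where f: "fst f = fst a"
      and nx: "\<And>g. g \<in> Ed \<Longrightarrow> fst g = fst a \<Longrightarrow> slope a < slope g \<Longrightarrow> slope f \<le> slope g"
      and w: "fst a $ 1 < w $ 1" "w $ 2 \<le> height f (w $ 1)"
      using first_vertexE[OF ab(3,1)] by metis
    have "slope f \<le> slope b" using nx ab \<open>\<not> slope b \<le> slope a\<close> by simp
    then have "height f (w $ 1) \<le> height b (w $ 1)"
      using f ab(5) w by (simp add: height_def mult_right_mono)
    then show False using ab(4) w by simp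
  qed
  show ?thesis using *[of e e'] *[of e' e] assms v edge_eqI[of e e'] by force
qed

text \<open>Each edge that is not the topmost one leaving its left endpoint is charged to the first vertex
  met in the wedge between it and the next edge. That wedge is empty to the left of this vertex, so
  a vertex is charged at most once from a wedge whose lower edge contains it, and at most once from
  a wedge whose lower edge is strictly below it.\<close>

lemma card_edges_le: "card Ed \<le> 3 * card S"
proof -
  define T where "T = {e \<in> Ed. \<forall>g\<in>Ed. fst g = fst e \<longrightarrow> slope g \<le> slope e}"
  define \<phi> where "\<phi> e = (SOME w. first_vertex e w)" for e
  define A where "A = {e \<in> Ed - T. height e (\<phi> e $ 1) = \<phi> e $ 2}"
  define B where "B = {e \<in> Ed - T. height e (\<phi> e $ 1) < \<phi> e $ 2}"
  have \<phi>: "first_vertex e (\<phi> e)" if "e \<in> Ed - T" for e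
  proof -
    have "\<not> (\<forall>g\<in>Ed. fst g = fst e \<longrightarrow> slope g \<le> slope e)"
      using that unfolding T_def by blast
    then obtain g where "g \<in> Ed" "fst g = fst e" "slope e < slope g"
      by (meson not_le)
    then have "\<exists>w. first_vertex e w" using that by (intro first_vertex_exists) auto
    then show ?thesis unfolding \<phi>_def by (rule someI_ex)
  qed
  have \<phi>S: "\<phi> e \<in> S" "height e (\<phi> e $ 1) \<le> \<phi> e $ 2" if "e \<in> Ed - T" for e
    using first_vertexE[OF \<phi>[OF that]] that by blast+
  have "inj_on fst T"
  proof (rule inj_onI)
    fix e e' assume *: "e \<in> T" "e' \<in> T" "fst e = fst e'"
    then have "slope e = slope e'" by (simp add: T_def order_antisym)
    then show "e = e'" using * edge_eqI by (simp add: T_def)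
  qed
  then have T: "card T \<le> card S"
    using edges_sub finite_S by (intro card_inj_on_le) (auto simp: T_def)
  have "inj_on \<phi> A"
  proof (rule inj_onI)
    fix e e' assume "e \<in> A" "e' \<in> A" "\<phi> e = \<phi> e'"
    then show "e = e'"
      using first_vertex_on_edge_inj[of e e' "\<phi> e"] \<phi>[of e] \<phi>[of e'] by (simp add: A_def)
  qed
  then have A: "card A \<le> card S"
    using \<phi>S finite_S by (intro card_inj_on_le) (auto simp: A_def)
  have "inj_on \<phi> B"
  proof (rule inj_onI)
    fix e e' assume "e \<in> B" "e' \<in> B" "\<phi> e = \<phi> e'"
    then show "e = e'"
      using first_vertex_above_edge_inj[of e e' "\<phi> e"] \<phi>[of e] \<phi>[of e'] by (simp add: B_def)
  qed
  then have B: "card B \<le> card S"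
    using \<phi>S finite_S by (intro card_inj_on_le) (auto simp: B_def)
  have "Ed = T \<union> (A \<union> B)"
    using \<phi>S(2) by (auto simp: A_def B_def T_def order_le_less)
  then have "card Ed \<le> card T + (card A + card B)"
    using card_Un_le[of T "A \<union> B"] card_Un_le[of A B] by simp
  then show ?thesis using T A B by simp
qed

end

section \<open>The crossing lemma\<close>

text \<open>While a crossing remains, deleting one of its edges lowers the left side by one and the
  number of ordered crossing pairs by at least one. Without crossings the linear bound
  applies.\<close>

lemma card_edges_le_crossings:
  assumes "finite S" "Ed \<subseteq> S \<times> S"
    and "\<And>e. e \<in> Ed \<Longrightarrow> fst e $ 1 < snd e $ 1"
    and "\<And>e f. e \<in> Ed \<Longrightarrow> f \<in> Ed \<Longrightarrow> fst e = fst f \<Longrightarrow> slope e = slope f \<Longrightarrow> e = f"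
  shows "card Ed \<le> 3 * card S + card {(e, f). e \<in> Ed \<and> f \<in> Ed \<and> crossing e f}"
proof -
  have "finite Ed" using assms(1,2) by (meson finite_SigmaI finite_subset)
  then show ?thesis using assms(2-)
  proof (induction Ed rule: finite_psubset_induct)
    case (psubset Ed)
    let ?C = "\<lambda>Ed. {(e, f). e \<in> Ed \<and> f \<in> Ed \<and> crossing e f}"
    show ?case
    proof (cases "\<exists>e\<in>Ed. \<exists>f\<in>Ed. crossing e f")
      case False
      then interpret noncrossing_graph S Ed
        using assms(1) psubset.prems by unfold_locales blast+
      show ?thesis using card_edges_le by simp
    next
      case True
      then obtain e f where ef: "e \<in> Ed" "f \<in> Ed" "crossing e f" by blast
      let ?E = "Ed - {e}"
      have IH: "card ?E \<le> 3 * card S + card (?C ?E)"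
        using psubset.prems ef(1) by (intro psubset.IH) blast+
      have fin: "finite (?C Ed)"
        by (rule finite_subset[of _ "Ed \<times> Ed"]) (use psubset.hyps in auto)
      have "card (?C ?E) < card (?C Ed)"
        using ef by (intro psubset_card_mono fin) auto
      moreover have "card Ed = Suc (card ?E)"
        using card.remove[OF psubset.hyps(1) ef(1)] by simp
      ultimately show ?thesis using IH by simp
    qed
  qed
qed

text \<open>The probability that all of \<open>T\<close> survives the sampling, with denominators
  cleared to stay in the natural numbers.\<close>

lemma card_functions_vanishing:
  fixes q :: nat
  assumes "finite V" "T \<subseteq> V" "q > 0"
  shows "card {f \<in> V \<rightarrow>\<^sub>E {..<q}. \<forall>v\<in>T. f v = 0} * q ^ card T = q ^ card V"
proof -
  have "{f \<in> V \<rightarrow>\<^sub>E {..<q}. \<forall>v\<in>T. f v = 0} = PiE V (\<lambda>v. if v \<in> T then {0} else {..<q})"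
    (is "?L = ?R")
  proof (intro set_eqI iffI)
    fix f assume "f \<in> ?L"
    then show "f \<in> ?R" by (auto simp: PiE_iff)
  next
    fix f assume f: "f \<in> ?R"
    have "f v < q" if "v \<in> V" for v
      using PiE_mem[OF f that] assms(3) by (simp split: if_splits)
    moreover have "f v = 0" if "v \<in> T" for v
      using PiE_mem[OF f, of v] assms(2) that by auto
    ultimately show "f \<in> ?L" using f by (simp add: PiE_iff)
  qed
  then have "card {f \<in> V \<rightarrow>\<^sub>E {..<q}. \<forall>v\<in>T. f v = 0} = (\<Prod>v\<in>V. if v \<in> T then 1 else q)"
    using assms by (simp add: card_PiE if_distrib cong: if_cong)
  also have "\<dots> = q ^ card (V - T)"
    using assms by (simp add: prod.If_cases Diff_eq Int_absorb1)
  finally show ?thesis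
    using assms by (simp add: card_Diff_subset finite_subset card_mono flip: power_add)
qed

lemma sum_card_filter_swap:
  assumes "finite A" "finite B"
  shows "(\<Sum>a\<in>A. card {b \<in> B. P a b}) = (\<Sum>b\<in>B. card {a \<in> A. P a b})"
  using sum.swap[of "\<lambda>a b. if P a b then 1 else (0::nat)" B A] assms
  by (simp add: sum.If_cases Int_def)

text \<open>Lines of different slope meet only once, and a crossing point is interior to both edges,
  so no endpoint is shared. A crossing pair hence survives sampling with probability
  \<open>1 / q ^ 4\<close>.\<close>

lemma crossing_distinct:
  assumes "crossing e f" "fst e $ 1 < snd e $ 1" "fst f $ 1 < snd f $ 1"
  shows "card {fst e, snd e, fst f, snd f} = 4"
proof -
  obtain x where x: "fst e $ 1 < x" "x < snd e $ 1" "fst f $ 1 < x" "x < snd f $ 1"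
    and eq: "height e x = height f x" and s: "slope e \<noteq> slope f"
    using assms by (auto simp: crossing_def)
  have "x = y" if "height e y = height f y" for y
  proof -
    have "(slope e - slope f) * (x - y) = 0"
      using height_shift[of e x y] height_shift[of f x y] eq that by (simp add: algebra_simps)
    then show ?thesis using s by simp
  qed
  then have "fst e \<noteq> fst f" "snd e \<noteq> snd f"
    using x assms height_fst[of e] height_fst[of f] height_snd[of e] height_snd[of f]
    by (metis less_irrefl)+
  moreover have "fst e \<noteq> snd e" "fst e \<noteq> snd f" "snd e \<noteq> fst f" "fst f \<noteq> snd f"
    using x by auto
  ultimately show ?thesis by simp
qed

text \<open>A random map from the vertices to \<open>{..<q}\<close> keeps the vertices it sends to 0, so that each
  vertex survives independently with probability \<open>1 / q\<close>.\<close>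

lemma crossing_lemma:
  fixes q :: nat
  assumes V: "finite V" "Ed \<subseteq> V \<times> V" "q > 0"
    and less: "\<And>e. e \<in> Ed \<Longrightarrow> fst e $ 1 < snd e $ 1"
    and simple: "\<And>e f. e \<in> Ed \<Longrightarrow> f \<in> Ed \<Longrightarrow> fst e = fst f \<Longrightarrow> slope e = slope f \<Longrightarrow> e = f"
  shows "card Ed * q ^ 2 \<le> 3 * card V * q ^ 3 + card {(e, f). e \<in> Ed \<and> f \<in> Ed \<and> crossing e f}"
proof -
  define \<Omega> where "\<Omega> = V \<rightarrow>\<^sub>E {..<q}"
  define C where "C = {(e, f). e \<in> Ed \<and> f \<in> Ed \<and> crossing e f}"
  have fin: "finite \<Omega>" "finite Ed" "finite C"
  proof -
    show "finite \<Omega>" using V by (simp add: \<Omega>_def finite_PiE)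
    show "finite Ed" using V by (meson finite_SigmaI finite_subset)
    then show "finite C" by (intro finite_subset[of C "Ed \<times> Ed"]) (auto simp: C_def)
  qed
  have vertices: "fst e \<in> V" "snd e \<in> V" if "e \<in> Ed" for e
    using V(2) that by (metis mem_Times_iff subsetD)+
  \<comment> \<open>The common denominator \<open>q ^ 4\<close> turns the survival probabilities of
    a vertex, an edge and a crossing into the weights \<open>q ^ 3\<close>, \<open>q ^ 2\<close> and
    1.\<close>
  have count: "card {\<omega> \<in> \<Omega>. \<forall>v\<in>T. \<omega> v = 0} * q ^ 4 = q ^ card V * q ^ (4 - card T)"
    if "T \<subseteq> V" "card T \<le> 4" for T
  proof -
    have "q ^ 4 = q ^ card T * q ^ (4 - card T)" using that by (simp flip: power_add)
    then have "card {\<omega> \<in> \<Omega>. \<forall>v\<in>T. \<omega> v = 0} * q ^ 4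
        = (card {\<omega> \<in> \<Omega>. \<forall>v\<in>T. \<omega> v = 0} * q ^ card T) * q ^ (4 - card T)"
      by (simp only: mult.assoc)
    then show ?thesis
      unfolding \<Omega>_def card_functions_vanishing[OF V(1) that(1) V(3)] .
  qed
  have step: "card {e \<in> Ed. \<forall>v\<in>{fst e, snd e}. \<omega> v = 0}
      \<le> 3 * card {v \<in> V. \<forall>u\<in>{v}. \<omega> u = 0}
        + card {p \<in> C. \<forall>v\<in>{fst (fst p), snd (fst p), fst (snd p), snd (snd p)}. \<omega> v = 0}"
    for \<omega> :: "real^2 \<Rightarrow> nat"
  proof -
    let ?S = "{v \<in> V. \<forall>u\<in>{v}. \<omega> u = 0}" and ?E = "{e \<in> Ed. \<forall>v\<in>{fst e, snd e}. \<omega> v = 0}"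
    have "card ?E \<le> 3 * card ?S + card {(e, f). e \<in> ?E \<and> f \<in> ?E \<and> crossing e f}"
    proof (rule card_edges_le_crossings)
      show "finite ?S" using V(1) by simp
      show "?E \<subseteq> ?S \<times> ?S" using vertices by (auto simp: mem_Times_iff)
    qed (use less simple in blast)+
    also have "{(e, f). e \<in> ?E \<and> f \<in> ?E \<and> crossing e f}
        = {p \<in> C. \<forall>v\<in>{fst (fst p), snd (fst p), fst (snd p), snd (snd p)}. \<omega> v = 0}"
      by (auto simp: C_def)
    finally show ?thesis by (simp only:)
  qed
  have E: "(\<Sum>\<omega>\<in>\<Omega>. card {e \<in> Ed. \<forall>v\<in>{fst e, snd e}. \<omega> v = 0}) * q ^ 4 = q ^ card V * (card Ed * q ^ 2)"
  proof -
    have "card {\<omega> \<in> \<Omega>. \<forall>v\<in>{fst e, snd e}. \<omega> v = 0} * q ^ 4 = q ^ card V * q ^ 2" if "e \<in> Ed" for e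
    proof -
      have "card {fst e, snd e} = 2" using less[OF that] by (auto simp: card_insert_if)
      then show ?thesis using count[of "{fst e, snd e}"] vertices[OF that] by simp
    qed
    then show ?thesis
      by (simp only: sum_card_filter_swap[OF fin(1,2)] sum_distrib_right sum_constant cong: sum.cong) simp
  qed
  have S: "(\<Sum>\<omega>\<in>\<Omega>. card {v \<in> V. \<forall>u\<in>{v}. \<omega> u = 0}) * q ^ 4 = q ^ card V * (card V * q ^ 3)"
  proof -
    have "card {\<omega> \<in> \<Omega>. \<forall>u\<in>{v}. \<omega> u = 0} * q ^ 4 = q ^ card V * q ^ 3" if "v \<in> V" for v
      using count[of "{v}"] that by auto
    then show ?thesis
      by (simp only: sum_card_filter_swap[OF fin(1) V(1)] sum_distrib_right sum_constant cong: sum.cong) simp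
  qed
  have C: "(\<Sum>\<omega>\<in>\<Omega>. card {p \<in> C. \<forall>v\<in>{fst (fst p), snd (fst p), fst (snd p), snd (snd p)}. \<omega> v = 0}) * q ^ 4
      = q ^ card V * card C"
  proof -
    have "card {\<omega> \<in> \<Omega>. \<forall>v\<in>{fst (fst p), snd (fst p), fst (snd p), snd (snd p)}. \<omega> v = 0} * q ^ 4
        = q ^ card V" if "p \<in> C" for p
    proof -
      have p: "fst p \<in> Ed" "snd p \<in> Ed" "crossing (fst p) (snd p)"
        using that by (auto simp: C_def)
      have "card {fst (fst p), snd (fst p), fst (snd p), snd (snd p)} = 4"
        using p less by (intro crossing_distinct) auto
      then show ?thesis
        using count[of "{fst (fst p), snd (fst p), fst (snd p), snd (snd p)}"] p(1,2) vertices
        by simp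
    qed
    then show ?thesis
      by (simp only: sum_card_filter_swap[OF fin(1,3)] sum_distrib_right sum_constant cong: sum.cong) simp
  qed
  have "q ^ card V * (card Ed * q ^ 2) \<le> q ^ card V * (3 * card V * q ^ 3 + card C)"
  proof -
    have "(\<Sum>\<omega>\<in>\<Omega>. card {e \<in> Ed. \<forall>v\<in>{fst e, snd e}. \<omega> v = 0})
        \<le> 3 * (\<Sum>\<omega>\<in>\<Omega>. card {v \<in> V. \<forall>u\<in>{v}. \<omega> u = 0})
          + (\<Sum>\<omega>\<in>\<Omega>. card {p \<in> C. \<forall>v\<in>{fst (fst p), snd (fst p), fst (snd p), snd (snd p)}. \<omega> v = 0})"
      using sum_mono[of \<Omega>, OF step] by (simp only: sum.distrib sum_distrib_left)
    then have "q ^ card V * (card Ed * q ^ 2)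
        \<le> (3 * (\<Sum>\<omega>\<in>\<Omega>. card {v \<in> V. \<forall>u\<in>{v}. \<omega> u = 0})
          + (\<Sum>\<omega>\<in>\<Omega>. card {p \<in> C. \<forall>v\<in>{fst (fst p), snd (fst p), fst (snd p), snd (snd p)}. \<omega> v = 0})) * q ^ 4"
      unfolding E[symmetric] by (rule mult_right_mono) simp
    then show ?thesis
      by (simp only: add_mult_distrib mult.assoc S C) (simp add: algebra_simps)
  qed
  then show ?thesis using V(3) by (simp add: C_def)
qed

section \<open>Parallel classes of lines covering a point set\<close>

text \<open>The value \<open>v $ 2 - s * v $ 1\<close> is the intercept of the line of slope
  \<open>s\<close> through \<open>v\<close>, so \<open>k\<close> bounds the number of lines of each
  slope needed to cover \<open>F\<close>. The crossing lemma is applied to the graph joining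
  consecutive points on these lines.\<close>

lemma card_parallel_cover:
  fixes q k :: nat and F :: "(real^2) set" and Sl :: "real set"
  assumes F: "finite F" and Sl: "finite Sl" and q: "q > 0"
    and k: "\<And>s. s \<in> Sl \<Longrightarrow> card ((\<lambda>v. v $ 2 - s * v $ 1) ` F) \<le> k"
  shows "card F * card Sl * q ^ 2 \<le> card Sl * k * q ^ 2 + 3 * card F * q ^ 3 + (card Sl * k) ^ 2"
proof -
  define Ed where "Ed = {e \<in> F \<times> F. fst e $ 1 < snd e $ 1 \<and> slope e \<in> Sl \<and>
    (\<forall>z\<in>F. fst e $ 1 < z $ 1 \<and> z $ 1 < snd e $ 1 \<longrightarrow> z $ 2 \<noteq> height e (z $ 1))}"
  \<comment> \<open>Lines are encoded by slope and intercept. In \<open>R\<close> below, a point is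
    paired with a slope when it is the rightmost point of \<open>F\<close> on its line of that
    slope; \<open>params e\<close> is the line carrying \<open>e\<close>.\<close>
  define L where "L = Sigma Sl (\<lambda>s. (\<lambda>v. v $ 2 - s * v $ 1) ` F)"
  define R where "R = {(s, u). s \<in> Sl \<and> u \<in> F \<and> (\<forall>z\<in>F. u $ 1 < z $ 1 \<longrightarrow> z $ 2 \<noteq> u $ 2 + s * (z $ 1 - u $ 1))}"
  define C where "C = {(e, f). e \<in> Ed \<and> f \<in> Ed \<and> crossing e f}"
  define params where "params e = (slope e, fst e $ 2 - slope e * fst e $ 1)" for e
  have finL: "finite L" using F Sl by (simp add: L_def)
  have cardL: "card L \<le> card Sl * k"
    using F Sl k sum_bounded_above[of Sl "\<lambda>s. card ((\<lambda>v. v $ 2 - s * v $ 1) ` F)" k]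
    by (simp add: L_def card_SigmaI)
  have Ed_sub: "Ed \<subseteq> F \<times> F" by (auto simp: Ed_def)
  have finEd: "finite Ed" using F Ed_sub by (meson finite_SigmaI finite_subset)
  \<comment> \<open>Edges on one line have disjoint interiors, so a common interior abscissa
    identifies them.\<close>
  have Ed_eq: "e = f"
    if "e \<in> Ed" "f \<in> Ed" "\<And>x. height e x = height f x" "fst e $ 1 < x" "x < snd e $ 1"
      "fst f $ 1 < x" "x < snd f $ 1" for e f x
  proof -
    have sub: "fst e = fst f \<and> snd e = snd f"
    proof -
      have e: "fst e \<in> F" "snd e \<in> F" "fst e $ 1 < snd e $ 1" "height e (fst e $ 1) = fst e $ 2"
          "height e (snd e $ 1) = snd e $ 2"
          "\<And>z. z \<in> F \<Longrightarrow> fst e $ 1 < z $ 1 \<Longrightarrow> z $ 1 < snd e $ 1 \<Longrightarrow> z $ 2 \<noteq> height e (z $ 1)"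
        using that(1) by (auto simp: Ed_def)
      have f: "fst f \<in> F" "snd f \<in> F" "fst f $ 1 < snd f $ 1" "height e (fst f $ 1) = fst f $ 2"
          "height e (snd f $ 1) = snd f $ 2"
          "\<And>z. z \<in> F \<Longrightarrow> fst f $ 1 < z $ 1 \<Longrightarrow> z $ 1 < snd f $ 1 \<Longrightarrow> z $ 2 \<noteq> height e (z $ 1)"
        using that(2,3) by (auto simp: Ed_def)
      have "fst f $ 1 \<le> fst e $ 1" "snd e $ 1 \<le> snd f $ 1"
        using e(6)[OF f(1)] e(6)[OF f(2)] f(4,5) that(4-) by linarith+
      moreover have "fst e $ 1 \<le> fst f $ 1" "snd f $ 1 \<le> snd e $ 1"
        using f(6)[OF e(1)] f(6)[OF e(2)] e(4,5) that(4-) by linarith+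
      ultimately have 1: "fst e $ 1 = fst f $ 1" "snd e $ 1 = snd f $ 1" by linarith+
      moreover have "fst e $ 2 = fst f $ 2" "snd e $ 2 = snd f $ 2"
        unfolding e(4,5)[symmetric] f(4,5)[symmetric] 1 by (rule refl)+
      ultimately show ?thesis by (blast intro: point_eqI)
    qed
    then show ?thesis by (simp add: prod_eq_iff)
  qed
  have height_line: "height e x = snd (params e) + fst (params e) * x" for e x
    by (simp add: params_def height_def algebra_simps)
  have simple: "e = f" if "e \<in> Ed" "f \<in> Ed" "fst e = fst f" "slope e = slope f" for e f
  proof -
    let ?x = "(fst e $ 1 + min (snd e $ 1) (snd f $ 1)) / 2"
    have "fst e $ 1 < snd e $ 1" "fst f $ 1 < snd f $ 1" using that by (auto simp: Ed_def)
    then show ?thesis using that by (intro Ed_eq[of e f ?x]) (auto simp: height_def)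
  qed
  \<comment> \<open>For each slope, every point either has a successor on its line, giving an edge,
    or is the last point of its line, and a line has only one such point.\<close>
  have "card F * card Sl \<le> card Ed + card L"
  proof -
    have "inj_on (\<lambda>(s, u). (s, u $ 2 - s * u $ 1)) R"
    proof (rule inj_onI)
      fix p p' assume p: "p \<in> R" "p' \<in> R" "(\<lambda>(s, u). (s, u $ 2 - s * u $ 1)) p = (\<lambda>(s, u). (s, u $ 2 - s * u $ 1)) p'"
      obtain s u v where su: "p = (s, u)" "p' = (s, v)" using p(3) by (cases p; cases p') auto
      have *: "(s, u) \<in> R" "(s, v) \<in> R" "u $ 2 - s * u $ 1 = v $ 2 - s * v $ 1"
        using p su by auto
      have "\<not> u $ 1 < v $ 1" "\<not> v $ 1 < u $ 1"
        using * by (auto simp: R_def algebra_simps)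
      then have "u $ 1 = v $ 1" by simp
      then have "u = v" using *(3) by (intro point_eqI) auto
      then show "p = p'" by (simp add: su)
    qed
    then have cardR: "card R \<le> card L"
      using finL by (intro card_inj_on_le) (auto simp: R_def L_def)
    have finR: "finite R"
      by (rule finite_subset[of _ "Sl \<times> F"]) (use F Sl in \<open>auto simp: R_def\<close>)
    have "Sl \<times> F - R \<subseteq> (\<lambda>e. (slope e, fst e)) ` Ed"
    proof
      fix p assume p: "p \<in> Sl \<times> F - R"
      obtain s u where su: "p = (s, u)" by (cases p)
      define Z where "Z = {z \<in> F. u $ 1 < z $ 1 \<and> z $ 2 = u $ 2 + s * (z $ 1 - u $ 1)}"
      have Z: "finite Z" "Z \<noteq> {}" using p F by (auto simp: Z_def R_def su)
      define w where "w = arg_min_on (\<lambda>z. z $ 1) Z"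
      have w: "w \<in> Z" "\<And>z. z \<in> Z \<Longrightarrow> w $ 1 \<le> z $ 1"
        using arg_min_if_finite[OF Z, of "\<lambda>z. z $ 1"] by (force simp: w_def)+
      have sl: "slope (u, w) = s" using w(1) by (simp add: slope_def Z_def)
      have "(u, w) \<in> Ed"
        using w p su sl by (force simp: Ed_def height_def Z_def)
      then show "p \<in> (\<lambda>e. (slope e, fst e)) ` Ed"
        using sl su by force
    qed
    then have "card (Sl \<times> F - R) \<le> card Ed"
      using finEd by (meson card_image_le card_mono finite_imageI order_trans)
    moreover have "card (Sl \<times> F) - card R \<le> card (Sl \<times> F - R)"
      by (rule diff_card_le_card_Diff[OF finR])
    ultimately show ?thesis using cardR by (simp add: card_cartesian_product mult.commute)
  qed
  then have main: "card F * card Sl \<le> card Ed + card Sl * k" using cardL by simp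
  have "card C \<le> (card Sl * k) ^ 2"
  proof -
    \<comment> \<open>The two lines determine their meeting point, and this point determines the
      edge on each line.\<close>
    have "inj_on (map_prod params params) C"
    proof (rule inj_onI)
      fix p p' assume p: "p \<in> C" "p' \<in> C" "map_prod params params p = map_prod params params p'"
      obtain e f where ef: "p = (e, f)" by (cases p)
      obtain e' f' where ef': "p' = (e', f')" by (cases p')
      have l: "params e = params e'" "params f = params f'" using p ef ef' by auto
      have h: "height e z = height e' z" "height f z = height f' z" for z
        using l by (simp_all add: height_line)
      have E: "e \<in> Ed" "f \<in> Ed" "e' \<in> Ed" "f' \<in> Ed" "crossing e f" "crossing e' f'"
        using p ef ef' by (auto simp: C_def)
      obtain x where x: "fst e $ 1 < x" "x < snd e $ 1" "fst f $ 1 < x" "x < snd f $ 1" "height e x = height f x"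
        and ne: "slope e \<noteq> slope f"
        using E by (auto simp: crossing_def)
      obtain y where y: "fst e' $ 1 < y" "y < snd e' $ 1" "fst f' $ 1 < y" "y < snd f' $ 1" "height e' y = height f' y"
        using E by (auto simp: crossing_def)
      have "(slope e - slope f) * (x - y) = 0"
        using height_shift[of e x y] height_shift[of f x y] x(5) y(5) h by (simp add: algebra_simps)
      then have "x = y" using ne by simp
      then have "e = e'" "f = f'"
        using Ed_eq[of e e' x] Ed_eq[of f f' x] E h x y by blast+
      then show "p = p'" using ef ef' by simp
    qed
    moreover have "map_prod params params ` C \<subseteq> L \<times> L"
      by (auto simp: C_def L_def params_def Ed_def)
    ultimately have "card C \<le> card (L \<times> L)"
      using finL by (intro card_inj_on_le) auto
    also have "\<dots> \<le> (card Sl * k) ^ 2"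
      using cardL by (simp add: power2_eq_square card_cartesian_product mult_le_mono del: mult_le_cancel1 mult_le_cancel2)
    finally show ?thesis .
  qed
  moreover have "card Ed * q ^ 2 \<le> 3 * card F * q ^ 3 + card C"
    unfolding C_def
    by (rule crossing_lemma[OF F Ed_sub q]) (use simple in \<open>auto simp: Ed_def\<close>)
  moreover have "card F * card Sl * q ^ 2 \<le> (card Ed + card Sl * k) * q ^ 2"
    using main by (rule mult_right_mono) simp
  ultimately show ?thesis by (simp add: algebra_simps)
qed

text \<open>With exactly \<open>4 * q\<close> slopes and sampling probability \<open>1 / q\<close>,
  the vertex term takes three quarters of the left side. The hypothesis on \<open>8 * k\<close>
  keeps the line term below half of the rest, so the crossing term must account for what
  remains.\<close>

lemma parallel_cover_bound:
  fixes q k :: nat and F :: "(real^2) set" and Sl :: "real set"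
  assumes F: "finite F" and Sl: "finite Sl" "4 * q \<le> card Sl" and kF: "8 * k \<le> card F"
    and k: "\<And>s. s \<in> Sl \<Longrightarrow> card ((\<lambda>v. v $ 2 - s * v $ 1) ` F) \<le> k"
  shows "card F * q \<le> 32 * k ^ 2"
proof (cases "q = 0")
  case False
  obtain T where T: "T \<subseteq> Sl" "card T = 4 * q" "finite T"
    using obtain_subset_with_card_n[OF Sl(2)] by blast
  have "card F * (4 * q) * q ^ 2 \<le> 4 * q * k * q ^ 2 + 3 * card F * q ^ 3 + (4 * q * k) ^ 2"
    using card_parallel_cover[of F T q k] F T False k by auto
  then have "q ^ 2 * (4 * card F * q) \<le> q ^ 2 * (4 * k * q + 3 * card F * q + 16 * k ^ 2)"
    by (simp add: power2_eq_square power3_eq_cube algebra_simps)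
  then have "4 * card F * q \<le> 4 * k * q + 3 * card F * q + 16 * k ^ 2"
    using False by simp
  moreover have "8 * k * q \<le> card F * q" using kF by (rule mult_right_mono) simp
  ultimately show ?thesis by (simp only: mult.assoc)
qed simp

section \<open>Pinned dot products\<close>

lemma pinned_dot_product_set_eq: "pinned_dot_product_set x F = (\<lambda>q. x \<bullet> q) ` F"
  by (auto simp: pinned_dot_product_set_def)

lemma card_le_card_pinned:
  assumes "finite F" "A \<subseteq> F" "inj_on (\<lambda>q. x \<bullet> q) A"
  shows "card A \<le> card (pinned_dot_product_set x F)"
  unfolding pinned_dot_product_set_eq using assms by (intro card_inj_on_le[OF assms(3)]) auto

lemma inner_real2: "x \<bullet> (y :: real^2) = x $ 1 * y $ 1 + x $ 2 * y $ 2"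
  by (simp add: inner_vec_def sum_2)

lemma inj_on_inner_orthogonal:
  fixes x y :: "real^2"
  assumes "x \<noteq> 0" "y \<noteq> 0" "x \<bullet> y = 0"
  shows "inj_on (\<lambda>z. x \<bullet> z) {z. z \<bullet> y = 0}"
proof (rule inj_onI, clarify)
  fix z z' assume z: "z \<bullet> y = 0" "z' \<bullet> y = 0" "x \<bullet> z = x \<bullet> z'"
  define d where "d = z - z'"
  \<comment> \<open>The determinant of \<open>x\<close> and \<open>y\<close>, nonzero by the
    Lagrange identity. Cramer's rule then forces \<open>d\<close> to vanish.\<close>
  define D where "D = x $ 1 * y $ 2 - x $ 2 * y $ 1"
  have d: "x $ 1 * d $ 1 + x $ 2 * d $ 2 = 0" "y $ 1 * d $ 1 + y $ 2 * d $ 2 = 0"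
    using z by (simp_all add: d_def inner_real2 algebra_simps)
  have "D ^ 2 = (x \<bullet> x) * (y \<bullet> y) - (x \<bullet> y) ^ 2"
    by (simp add: D_def inner_real2 power2_eq_square algebra_simps)
  then have "D \<noteq> 0" using assms by auto
  moreover have *: "D * d $ 1 = y $ 2 * (x $ 1 * d $ 1 + x $ 2 * d $ 2) - x $ 2 * (y $ 1 * d $ 1 + y $ 2 * d $ 2)"
    "D * d $ 2 = x $ 1 * (y $ 1 * d $ 1 + y $ 2 * d $ 2) - y $ 1 * (x $ 1 * d $ 1 + x $ 2 * d $ 2)"
    by (simp_all add: D_def algebra_simps)
  have "D * d $ 1 = 0" "D * d $ 2 = 0"
    unfolding * d by simp_all
  ultimately have "d $ 1 = 0" "d $ 2 = 0" by simp_all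
  then show "z = z'" by (simp add: d_def vec_eq_iff forall_2)
qed

lemma line_through_originE:
  assumes "line_through_origin L"
  obtains y where "y \<noteq> 0" "L \<subseteq> range (\<lambda>r. r *\<^sub>R y)"
proof -
  obtain B where B: "independent B" "L \<subseteq> span B" "card B = 1"
    using basis_exists[of L] assms by (metis line_through_origin_def)
  then obtain y where y: "B = {y}" by (meson card_1_singletonE)
  then have "y \<noteq> 0" using B(1) by (auto simp: dependent_zero)
  then show ?thesis using that[of y] B(2) y by (simp add: span_singleton)
qed

lemma line_through_origin_orthogonal:
  assumes "a \<noteq> 0"
  shows "line_through_origin {z. a \<bullet> z = 0}"
  using assms by (simp add: line_through_origin_def subspace_hyperplane dim_hyperplane)

section \<open>Points with few pinned dot products\<close>

lemma card_few_pinned_le: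
  fixes E F :: "(real^2) set" and t :: real
  assumes fin: "finite E" "finite F" and card: "real (card E) = t ^ 3" "real (card F) = t ^ 3"
    and t: "32 \<le> t"
    and lines: "\<And>L. line_through_origin L \<Longrightarrow> real (card (E \<inter> L)) \<le> t ^ 2"
  shows "2 * real (card {x \<in> E. real (card (pinned_dot_product_set x F)) < t ^ 2 / 64}) \<le> t ^ 3"
proof (rule ccontr)
  define B where "B = {x \<in> E. real (card (pinned_dot_product_set x F)) < t ^ 2 / 64}"
  \<comment> \<open>Points on the first axis are set aside, because the lines orthogonal to them are
    vertical; for the others \<open>sl x\<close> is the slope of these lines.\<close>
  define B' where "B' = {x \<in> B. x $ 2 \<noteq> 0}"
  define sl where "sl x = - x $ 1 / x $ 2" for x :: "real^2"
  define Sl where "Sl = sl ` B'"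
  define q where "q = nat \<lfloor>t / 16\<rfloor>"
  define k where "k = nat \<lfloor>t ^ 2 / 64\<rfloor>"
  assume "\<not> ?thesis"
  then have big: "t ^ 3 < 2 * real (card B)" by (simp add: B_def)
  have finB: "finite B" "finite B'" "finite Sl" using fin by (auto simp: B_def B'_def Sl_def)
  have "real (card (B - B')) \<le> t ^ 2"
  proof -
    have "B - B' \<subseteq> E \<inter> {z. axis 2 1 \<bullet> z = 0}"
      by (auto simp: B_def B'_def inner_axis')
    then have "card (B - B') \<le> card (E \<inter> {z. axis 2 1 \<bullet> z = 0})"
      using fin by (intro card_mono) auto
    moreover have "real (card (E \<inter> {z. axis 2 1 \<bullet> z = 0})) \<le> t ^ 2"
      by (intro lines line_through_origin_orthogonal) (simp add: axis_eq_0_iff)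
    ultimately show ?thesis by linarith
  qed
  moreover have "real (card B') \<le> real (card Sl) * t ^ 2"
  proof -
    have "real (card {x \<in> B'. sl x = s}) \<le> t ^ 2" for s
    proof -
      \<comment> \<open>Points with the same orthogonal slope lie on one line through the origin,
        where \<open>lines\<close> applies.\<close>
      have "{x \<in> B'. sl x = s} \<subseteq> E \<inter> {z. vector [1, s] \<bullet> z = 0}"
        by (auto simp: B_def B'_def sl_def inner_real2)
      then have "card {x \<in> B'. sl x = s} \<le> card (E \<inter> {z. vector [1, s] \<bullet> z = 0})"
        using fin by (intro card_mono) auto
      moreover have "(vector [1, s] :: real^2) \<noteq> 0"
        by (simp add: vec_eq_iff forall_2)
      then have "real (card (E \<inter> {z. vector [1, s] \<bullet> z = 0})) \<le> t ^ 2"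
        by (intro lines line_through_origin_orthogonal)
      ultimately show ?thesis by linarith
    qed
    then have "(\<Sum>s\<in>Sl. real (card {x \<in> B'. sl x = s})) \<le> real (card Sl) * t ^ 2"
      by (intro sum_bounded_above)
    moreover have "real (card B') = (\<Sum>s\<in>Sl. real (card {x \<in> B'. sl x = s}))"
      using sum.image_gen[OF finB(2), of "\<lambda>_. 1::real" sl] by (simp add: Sl_def)
    ultimately show ?thesis by simp
  qed
  moreover have "card B = card (B - B') + card B'"
    using finB by (subst card_Diff_subset) (auto simp: B'_def card_mono)
  \<comment> \<open>The summand 1 accounts for the points set aside on the first axis.\<close>
  ultimately have "t ^ 3 < t ^ 2 * (2 * (1 + real (card Sl)))"
    using big by (simp add: algebra_simps)
  then have "t < 2 + 2 * real (card Sl)"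
    using t by (simp add: power3_eq_cube power2_eq_square)
  then have "t / 4 \<le> real (card Sl)" using t by linarith
  moreover have q: "real q \<le> t / 16" "t / 32 \<le> real q"
    using t unfolding q_def by linarith+
  ultimately have "4 * q \<le> card Sl" by linarith
  moreover have k: "real k \<le> t ^ 2 / 64" unfolding k_def by (intro of_nat_floor) simp
  have "t ^ 2 * 1 \<le> t ^ 2 * t" using t by (intro mult_left_mono) auto
  then have "8 * k \<le> card F" using k card(2) by (simp add: power3_eq_cube power2_eq_square)
  moreover have "card ((\<lambda>v. v $ 2 - s * v $ 1) ` F) \<le> k" if s: "s \<in> Sl" for s
  proof -
    obtain x where x: "x \<in> B" "x $ 2 \<noteq> 0" "s = - x $ 1 / x $ 2"
      using s by (auto simp: Sl_def B'_def sl_def)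
    \<comment> \<open>Dividing \<open>x \<bullet> v\<close> by \<open>x $ 2\<close> gives exactly
      the intercept of the line of slope \<open>s\<close> through \<open>v\<close>.\<close>
    have "(\<lambda>v. v $ 2 - s * v $ 1) ` F = (\<lambda>r. r / x $ 2) ` pinned_dot_product_set x F"
      unfolding pinned_dot_product_set_eq image_image
      using x(2) by (intro image_cong) (auto simp: x(3) inner_real2 add_divide_distrib)
    then have "card ((\<lambda>v. v $ 2 - s * v $ 1) ` F) \<le> card (pinned_dot_product_set x F)"
      using fin by (simp add: card_image_le pinned_dot_product_set_eq)
    moreover have "real (card (pinned_dot_product_set x F)) < t ^ 2 / 64"
      using x by (simp add: B_def)
    ultimately show ?thesis unfolding k_def by linarith
  qed
  ultimately have "card F * q \<le> 32 * k ^ 2"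
    using fin finB by (intro parallel_cover_bound)
  then have "real (card F * q) \<le> real (32 * k ^ 2)" by (simp only: of_nat_le_iff)
  then have "t ^ 3 * real q \<le> 32 * real k ^ 2" by (simp add: card)
  moreover have "t ^ 3 * (t / 32) \<le> t ^ 3 * real q"
    using q t by (intro mult_left_mono) auto
  moreover have "real k ^ 2 \<le> (t ^ 2 / 64) ^ 2" using k by (intro power_mono) auto
  \<comment> \<open>The right side equals \<open>t ^ 4 / 128\<close>, a quarter of the left.\<close>
  ultimately have "t ^ 3 * (t / 32) \<le> 32 * (t ^ 2 / 64) ^ 2" by linarith
  then have "t ^ 4 \<le> t ^ 4 / 4"
    by (simp add: power_divide flip: power_Suc2 power_mult)
  moreover have "t ^ 4 > 0" using t by simp
  ultimately show False by linarith
qed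

text \<open>If a line \<open>L\<close> through the origin is rich in points of \<open>F\<close>, then every point with few dot
  products lies on the line orthogonal to \<open>L\<close>; were there many such points, that line would be rich
  as well, and its nonzero points would see many dot products along it.\<close>

lemma card_few_pinned_self_le:
  fixes F :: "(real^2) set" and t :: real
  assumes fin: "finite F" and card: "real (card F) = t ^ 3" and t: "32 \<le> t"
  shows "2 * real (card {x \<in> F. real (card (pinned_dot_product_set x F)) < t ^ 2 / 64}) \<le> t ^ 3"
proof (cases "\<forall>L. line_through_origin L \<longrightarrow> real (card (F \<inter> L)) \<le> t ^ 2")
  case True
  then show ?thesis using card_few_pinned_le[OF fin fin card card t] by blast
next
  case False
  then obtain L where L: "line_through_origin L" "t ^ 2 < real (card (F \<inter> L))"
    by (auto simp: not_le)
  obtain y where y: "y \<noteq> 0" "L \<subseteq> range (\<lambda>r. r *\<^sub>R y)"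
    using L(1) by (rule line_through_originE)
  define B where "B = {x \<in> F. real (card (pinned_dot_product_set x F)) < t ^ 2 / 64}"
  have t2: "t ^ 2 > 0" using t by simp
  have orth: "x \<bullet> y = 0" if "x \<in> B" for x
  proof (rule ccontr)
    assume "x \<bullet> y \<noteq> 0"
    \<comment> \<open>On multiples of \<open>y\<close>, taking the product with \<open>x\<close>
      scales by the nonzero number \<open>x \<bullet> y\<close>.\<close>
    have "inj_on (\<lambda>z. x \<bullet> z) (F \<inter> L)"
    proof (rule inj_onI)
      fix u v assume uv: "u \<in> F \<inter> L" "v \<in> F \<inter> L" "x \<bullet> u = x \<bullet> v"
      then obtain r s where "u = r *\<^sub>R y" "v = s *\<^sub>R y" using y(2) by blast
      then show "u = v" using uv(3) \<open>x \<bullet> y \<noteq> 0\<close> by simp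
    qed
    then have "card (F \<inter> L) \<le> card (pinned_dot_product_set x F)"
      using fin by (intro card_le_card_pinned) auto
    then show False using that L(2) t2 by (simp add: B_def)
  qed
  have "2 * real (card B) \<le> t ^ 3"
  proof (rule ccontr)
    assume big: "\<not> 2 * real (card B) \<le> t ^ 3"
    have "t ^ 2 * 32 \<le> t ^ 2 * t" using t by (intro mult_left_mono) auto
    then have t3: "32 * t ^ 2 \<le> t ^ 3" by (simp add: power3_eq_cube power2_eq_square)
    have "1 \<le> t ^ 2" using t by (intro one_le_power) auto
    then have "1 < card B" using big t3 by simp
    then have "\<not> B \<subseteq> {0}" using card_mono[of "{0}" B] by auto
    then obtain x where x: "x \<in> B" "x \<noteq> 0" by blast
    \<comment> \<open>All of \<open>B\<close> lies on the line orthogonal to \<open>y\<close>, which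
      is spanned by \<open>x\<close> itself.\<close>
    have "inj_on (\<lambda>z. x \<bullet> z) B"
      by (rule inj_on_subset[OF inj_on_inner_orthogonal[OF x(2) y(1) orth[OF x(1)]]]) (use orth in blast)
    then have "card B \<le> card (pinned_dot_product_set x F)"
      using fin by (intro card_le_card_pinned) (auto simp: B_def)
    then have "real (card B) < t ^ 2 / 64" using x(1) by (simp add: B_def)
    then show False using big t3 t2 by linarith
  qed
  then show ?thesis by (simp add: B_def)
qed

section \<open>Passage from the parameter \<open>t\<close> back to \<open>n\<close>\<close>

lemma cube_root_bounds:
  assumes "32 ^ 3 \<le> (n::nat)"
  shows "(real n powr (1/3)) ^ 3 = real n" "real n powr (2/3) = (real n powr (1/3)) ^ 2"
    and "32 \<le> real n powr (1/3)"
proof -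
  have n0: "0 < real n" using assms by simp
  then show t3: "(real n powr (1/3)) ^ 3 = real n" and "real n powr (2/3) = (real n powr (1/3)) ^ 2"
    by (simp_all add: powr_powr flip: powr_realpow)
  show "32 \<le> real n powr (1/3)"
  proof (rule ccontr)
    assume "\<not> 32 \<le> real n powr (1/3)"
    then have "(real n powr (1/3)) ^ 3 < 32 ^ 3" by (intro power_strict_mono) auto
    then show False using assms t3 by simp
  qed
qed

lemma many_pinned:
  assumes n: "32 ^ 3 \<le> n" and E: "finite E" "card E = n"
    and few: "2 * real (card {x \<in> E. real (card (pinned_dot_product_set x F)) < (real n powr (1/3)) ^ 2 / 64})
      \<le> (real n powr (1/3)) ^ 3"
  shows "\<exists>E'. E' \<subseteq> E \<and> real (card E') \<ge> 1/2 * real n \<and>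
    (\<forall>x\<in>E'. real (card (pinned_dot_product_set x F)) \<ge> 1/64 * real n powr (2/3))"
proof -
  let ?B = "{x \<in> E. real (card (pinned_dot_product_set x F)) < (real n powr (1/3)) ^ 2 / 64}"
  have "card (E - ?B) = card E - card ?B" "card ?B \<le> card E"
    using E(1) by (auto intro!: card_Diff_subset card_mono)
  then have "1/2 * real n \<le> real (card (E - ?B))"
    using few E(2) cube_root_bounds(1)[OF n] by (simp add: of_nat_diff)
  then show ?thesis
    by (intro exI[of _ "E - ?B"]) (auto simp: cube_root_bounds(2)[OF n])
qed

theorem theorem2p3:
  "\<exists>c::real. c > 0 \<and> (\<exists>N::nat. \<forall>n\<ge>N.
     (\<forall>E F :: (real^2) set.
        finite E \<and> finite F \<and> card E = n \<and> card F = n \<and>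
        (\<forall>L. line_through_origin L \<longrightarrow> real (card (E \<inter> L)) \<le> real n powr (2/3)) \<longrightarrow>
        (\<exists>E'. E' \<subseteq> E \<and> real (card E') \<ge> 1/2 * real n \<and>
           (\<forall>x\<in>E'. real (card (pinned_dot_product_set x F)) \<ge> c * real n powr (2/3)))) \<and>
     (\<forall>E F :: (real^2) set.
        finite E \<and> finite F \<and> card E = n \<and> card F = n \<and> E = F \<longrightarrow>
        (\<exists>E'. E' \<subseteq> E \<and> real (card E') \<ge> 1/2 * real n \<and>
           (\<forall>x\<in>E'. real (card (pinned_dot_product_set x F)) \<ge> c * real n powr (2/3)))))"
\<comment> \<open>The constant is the threshold defining few dot products, and the bound on
  \<open>n\<close> makes its cube root at least 32.\<close>
proof (intro exI[of _ "1/64 :: real"] exI[of _ "32 ^ 3 :: nat"] conjI allI impI)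
  show "(0::real) < 1 / 64" by simp
next
  fix n :: nat and E F :: "(real^2) set"
  assume "32 ^ 3 \<le> n" and
    "finite E \<and> finite F \<and> card E = n \<and> card F = n \<and>
      (\<forall>L. line_through_origin L \<longrightarrow> real (card (E \<inter> L)) \<le> real n powr (2/3))"
  then show "\<exists>E'. E' \<subseteq> E \<and> real (card E') \<ge> 1/2 * real n \<and>
      (\<forall>x\<in>E'. real (card (pinned_dot_product_set x F)) \<ge> 1/64 * real n powr (2/3))"
    using cube_root_bounds[of n] by (intro many_pinned card_few_pinned_le) auto
next
  fix n :: nat and E F :: "(real^2) set"
  assume "32 ^ 3 \<le> n" and "finite E \<and> finite F \<and> card E = n \<and> card F = n \<and> E = F"
  then show "\<exists>E'. E' \<subseteq> E \<and> real (card E') \<ge> 1/2 * real n \<and>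
      (\<forall>x\<in>E'. real (card (pinned_dot_product_set x F)) \<ge> 1/64 * real n powr (2/3))"
    using cube_root_bounds[of n] card_few_pinned_self_le[of F "real n powr (1/3)"]
    by (intro many_pinned) auto
qed

end
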